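(* Let $\alpha_1, A_1, \gamma_2 > 0$ and consider the system of difference equations $$x_{n+1}=\frac{\alpha_{1}}{A_{1}+y_{n}},\qquad y_{n+1}=\gamma_{2}y_{n},\qquad n=0,1,2,\dots,$$ with arbitrary nonnegative initial conditions $x_0,y_0$. (1) If $\gamma_{2}>1$, then for any choice of initial conditions with $y_{0}\neq 0$, $\lim_{n\rightarrow\infty}(x_{n},y_{n})=(0,\infty)$. Moreover, $(\bar{x},\bar{y})=\left(\frac{\alpha_{1}}{A_{1}},0\right)$ is a saddle equilibrium and $[0,\infty)\times \{0\}$ is its stable manifold. (2) If $\gamma_{2}=1$, then every point in the set $$\left\{\left(\frac{\alpha_{1}}{A_{1}+v},v\right) : v\in [0,\infty )\right\}$$ is a nonhyperbolic equilibrium point. Furthermore, for each $v\in [0,\infty )$, the set $[0,\infty)\times \{v\}$ is a stable manifold for the nonhyperbolic equilibrium $\left(\frac{\alpha_{1}}{A_{1}+v},v\right)$. (3) If $\gamma_{2}<1$, then there is a unique equilibrium, namely $(\bar{x},\bar{y})=\left(\frac{\alpha_{1}}{A_{1}},0\right)$, and it is globally asymptotically stable.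
   Context: The state space is $[0,\infty)^2$. An equilibrium is a point $(\bar x,\bar y)\in[0,\infty)^2$ such that the constant sequence $(x_n,y_n)=(\bar x,\bar y)$ solves the system. Consider the Jacobian matrix at the equilibrium of the map $(x_n,y_n)\mapsto(x_{n+1},y_{n+1})$: the equilibrium is a saddle if one eigenvalue has modulus less than 1 and the other has modulus greater than 1, and it is nonhyperbolic if some eigenvalue has modulus equal to 1. The stable manifold of an equilibrium is the set of initial conditions in $[0,\infty)^2$ whose solutions converge to that equilibrium. An equilibrium is globally asymptotically stable if it is Lyapunov stable relative to $[0,\infty)^2$ and every solution with initial condition in $[0,\infty)^2$ converges to it. The notation $\lim_{n\to\infty}(x_n,y_n)=(0,\infty)$ means $x_n\to 0$ and $y_n\to\infty$. *)

theory Defs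
  imports "HOL-Analysis.Analysis"
begin

text \<open>
  Points \<open>(x, y)\<close> of the plane are vectors in \<open>real ^ 2\<close>, so that the Jacobian is a library matrix.
  The map below is total on the plane; for \<open>A > 0\<close> its denominator is positive on a neighbourhood
  of the state space, so the two-sided derivative exists at every state, including boundary points.
\<close>

definition state_space :: "(real ^ 2) set" where
  "state_space = {z. z $ 1 \<ge> 0 \<and> z $ 2 \<ge> 0}"

definition system_map :: "real \<Rightarrow> real \<Rightarrow> real \<Rightarrow> real ^ 2 \<Rightarrow> real ^ 2" where
  "system_map \<alpha> A \<gamma> z = vector [\<alpha> / (A + z $ 2), \<gamma> * z $ 2]"

definition is_solution :: "(real ^ 2 \<Rightarrow> real ^ 2) \<Rightarrow> (nat \<Rightarrow> real ^ 2) \<Rightarrow> bool" where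
  "is_solution F z \<longleftrightarrow> z 0 \<in> state_space \<and> (\<forall>n. z (Suc n) = F (z n))"

definition equilibrium :: "(real ^ 2 \<Rightarrow> real ^ 2) \<Rightarrow> real ^ 2 \<Rightarrow> bool" where
  "equilibrium F p \<longleftrightarrow> p \<in> state_space \<and> is_solution F (\<lambda>n. p)"

definition jacobian :: "(real ^ 2 \<Rightarrow> real ^ 2) \<Rightarrow> real ^ 2 \<Rightarrow> real ^ 2 ^ 2" where
  "jacobian F p = matrix (frechet_derivative F (at p))"

text \<open>Eigenvalues of a real matrix are taken over the complex numbers.\<close>

definition complex_eigenvalue :: "real ^ 'n ^ 'n \<Rightarrow> complex \<Rightarrow> bool" where
  "complex_eigenvalue M l \<longleftrightarrow>
     (\<exists>v :: complex ^ 'n. v \<noteq> 0 \<and> (\<chi> i j. complex_of_real (M $ i $ j)) *v v = l *s v)"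

text \<open>
  Differentiability is demanded explicitly because \<^const>\<open>frechet_derivative\<close> is unspecified otherwise.
  In the saddle case the two eigenvalues have different moduli, hence they are distinct and exhaust
  the spectrum of the \<open>2 \<times> 2\<close> matrix.
\<close>

definition saddle_equilibrium :: "(real ^ 2 \<Rightarrow> real ^ 2) \<Rightarrow> real ^ 2 \<Rightarrow> bool" where
  "saddle_equilibrium F p \<longleftrightarrow>
     equilibrium F p \<and> F differentiable (at p) \<and>
     (\<exists>l m. complex_eigenvalue (jacobian F p) l \<and> complex_eigenvalue (jacobian F p) m \<and>
            norm l < 1 \<and> norm m > 1)"

definition nonhyperbolic_equilibrium :: "(real ^ 2 \<Rightarrow> real ^ 2) \<Rightarrow> real ^ 2 \<Rightarrow> bool" where
  "nonhyperbolic_equilibrium F p \<longleftrightarrow>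
     equilibrium F p \<and> F differentiable (at p) \<and>
     (\<exists>l. complex_eigenvalue (jacobian F p) l \<and> norm l = 1)"

definition stable_manifold :: "(real ^ 2 \<Rightarrow> real ^ 2) \<Rightarrow> real ^ 2 \<Rightarrow> (real ^ 2) set" where
  "stable_manifold F p =
     {z0 \<in> state_space. \<forall>z. is_solution F z \<and> z 0 = z0 \<longrightarrow> z \<longlonglongrightarrow> p}"

definition lyapunov_stable :: "(real ^ 2 \<Rightarrow> real ^ 2) \<Rightarrow> real ^ 2 \<Rightarrow> bool" where
  "lyapunov_stable F p \<longleftrightarrow>
     (\<forall>\<epsilon>>0. \<exists>\<delta>>0. \<forall>z. is_solution F z \<and> dist (z 0) p < \<delta> \<longrightarrow> (\<forall>n. dist (z n) p < \<epsilon>))"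

definition globally_asymptotically_stable :: "(real ^ 2 \<Rightarrow> real ^ 2) \<Rightarrow> real ^ 2 \<Rightarrow> bool" where
  "globally_asymptotically_stable F p \<longleftrightarrow>
     equilibrium F p \<and> lyapunov_stable F p \<and> (\<forall>z. is_solution F z \<longrightarrow> z \<longlonglongrightarrow> p)"

end

(*
  The system is explicitly solvable: y_n = g^n y_0 and x_(n+1) = a / (A + y_n). A solution therefore
  converges to (a / (A + v), v) iff g^n y_0 converges to v, which settles all stable manifolds. The
  Jacobian is upper triangular with eigenvalues 0 and g. For g < 1, stability follows from
  0 <= a / A - a / (A + y) <= (a / A^2) y.
*)
theory Submission
  imports Defs
begin

section \<open>Coordinates in the real plane\<close>

lemma vector_2_eq_iff:
  fixes p :: "real ^ 2"
  shows "p = vector [a, b] \<longleftrightarrow> p $ 1 = a \<and> p $ 2 = b"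
  by (auto simp: vec_eq_iff forall_2)

lemma tendsto_vector_2_iff:
  fixes z :: "'b \<Rightarrow> real ^ 2"
  shows "(z \<longlongrightarrow> vector [a, b]) F \<longleftrightarrow>
    ((\<lambda>n. z n $ 1) \<longlongrightarrow> a) F \<and> ((\<lambda>n. z n $ 2) \<longlongrightarrow> b) F"
proof
  assume "(z \<longlongrightarrow> vector [a, b]) F"
  from tendsto_vec_nth[OF this, of 1] tendsto_vec_nth[OF this, of 2]
  show "((\<lambda>n. z n $ 1) \<longlongrightarrow> a) F \<and> ((\<lambda>n. z n $ 2) \<longlongrightarrow> b) F" by simp
next
  assume *: "((\<lambda>n. z n $ 1) \<longlongrightarrow> a) F \<and> ((\<lambda>n. z n $ 2) \<longlongrightarrow> b) F"
  show "(z \<longlongrightarrow> vector [a, b]) F"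
  proof (rule vec_tendstoI)
    fix i :: 2
    show "((\<lambda>n. z n $ i) \<longlongrightarrow> (vector [a, b] :: real ^ 2) $ i) F"
      using exhaust_2[of i] * by auto
  qed
qed

lemma dist_vec_2_le:
  fixes p q :: "real ^ 2"
  shows "dist p q \<le> \<bar>p $ 1 - q $ 1\<bar> + \<bar>p $ 2 - q $ 2\<bar>"
  using norm_le_l1_cart[of "p - q"] by (simp add: dist_norm sum_2)

section \<open>Explicit solution, convergence and stable manifolds\<close>

lemma system_map_nth [simp]:
  "system_map \<alpha> A \<gamma> z $ 1 = \<alpha> / (A + z $ 2)"
  "system_map \<alpha> A \<gamma> z $ 2 = \<gamma> * z $ 2"
  by (simp_all add: system_map_def)

lemma solution_2:
  assumes "is_solution (system_map \<alpha> A \<gamma>) z"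
  shows "z n $ 2 = \<gamma> ^ n * z 0 $ 2"
  using assms by (induction n) (simp_all add: is_solution_def)

lemma solution_1_Suc:
  assumes "is_solution (system_map \<alpha> A \<gamma>) z"
  shows "z (Suc n) $ 1 = \<alpha> / (A + z n $ 2)"
  using assms by (simp add: is_solution_def)

lemma solution_nonneg:
  assumes "is_solution (system_map \<alpha> A \<gamma>) z" "\<gamma> \<ge> 0"
  shows "z n $ 2 \<ge> 0"
  using assms solution_2[OF assms(1), of n] by (simp add: is_solution_def state_space_def)

text \<open>Iterating \<open>F\<close> gives a solution. This keeps the universal quantifier over
  solutions in \<open>stable_manifold\<close> from being vacuous.\<close>

lemma ex_solution:
  assumes "p \<in> state_space"
  obtains z where "is_solution F z" "z 0 = p"
  using that[of "\<lambda>n. (F ^^ n) p"] assms by (simp add: is_solution_def)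

text \<open>From one step on, the first coordinate is a function of the previous second coordinate,
  continuous at \<open>v\<close> because \<open>A + v > 0\<close>. Hence the second coordinate alone
  decides convergence, whatever the value of \<open>z 0 $ 1\<close>.\<close>

lemma solution_tendsto_iff:
  assumes sol: "is_solution (system_map \<alpha> A \<gamma>) z" and "A > 0" "v \<ge> 0"
  shows "z \<longlonglongrightarrow> vector [\<alpha> / (A + v), v] \<longleftrightarrow> (\<lambda>n. \<gamma> ^ n * z 0 $ 2) \<longlonglongrightarrow> v"
proof -
  have eq: "(\<lambda>n. z n $ 2) = (\<lambda>n. \<gamma> ^ n * z 0 $ 2)"
    by (rule ext) (rule solution_2[OF sol])
  have "(\<lambda>n. z n $ 1) \<longlonglongrightarrow> \<alpha> / (A + v)" if "(\<lambda>n. z n $ 2) \<longlonglongrightarrow> v"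
  proof -
    have "(\<lambda>n. \<alpha> / (A + z n $ 2)) \<longlonglongrightarrow> \<alpha> / (A + v)"
      using assms by (intro tendsto_intros that) auto
    \<comment> \<open>The recursion says nothing about \<open>z 0 $ 1\<close>, so the limit is first
      found for the shifted sequence.\<close>
    then have "(\<lambda>n. z (Suc n) $ 1) \<longlonglongrightarrow> \<alpha> / (A + v)"
      by (simp add: solution_1_Suc[OF sol])
    then show ?thesis by (rule LIMSEQ_imp_Suc)
  qed
  then show ?thesis
    unfolding tendsto_vector_2_iff eq by blast
qed

text \<open>Reduces a stable manifold to a question about a scalar geometric sequence. It serves
  \<open>v = 0\<close> when \<gamma> > 1 and every \<open>v \<ge> 0\<close> when \<gamma> =
  1.\<close>

lemma stable_manifold_system_map:
  assumes "A > 0" "v \<ge> 0"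
  shows "stable_manifold (system_map \<alpha> A \<gamma>) (vector [\<alpha> / (A + v), v]) =
    {p \<in> state_space. (\<lambda>n. \<gamma> ^ n * p $ 2) \<longlonglongrightarrow> v}"
proof -
  have "(\<forall>z. is_solution (system_map \<alpha> A \<gamma>) z \<and> z 0 = p \<longrightarrow> z \<longlonglongrightarrow> vector [\<alpha> / (A + v), v]) \<longleftrightarrow>
      (\<lambda>n. \<gamma> ^ n * p $ 2) \<longlonglongrightarrow> v" if "p \<in> state_space" for p
  proof -
    obtain z where "is_solution (system_map \<alpha> A \<gamma>) z" "z 0 = p"
      using ex_solution[OF \<open>p \<in> state_space\<close>] .
    then show ?thesis using solution_tendsto_iff[OF _ assms] by blast
  qed
  then show ?thesis unfolding stable_manifold_def by blast
qed

section \<open>Equilibria, derivative and eigenvalues\<close>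

lemma equilibrium_system_map_iff:
  "equilibrium (system_map \<alpha> A \<gamma>) p \<longleftrightarrow>
     p \<in> state_space \<and> p $ 1 = \<alpha> / (A + p $ 2) \<and> p $ 2 = \<gamma> * p $ 2"
  by (auto simp: equilibrium_def is_solution_def vec_eq_iff forall_2)

lemma system_map_has_derivative:
  assumes "A + p $ 2 \<noteq> 0"
  shows "(system_map \<alpha> A \<gamma> has_derivative
    (\<lambda>h. vector [- \<alpha> / (A + p $ 2)\<^sup>2 * h $ 2, \<gamma> * h $ 2])) (at p)"
proof -
  have "((\<lambda>z :: real ^ 2. z $ 2) has_derivative (\<lambda>h. h $ 2)) (at p)"
    by (intro bounded_linear_imp_has_derivative bounded_linear_vec_nth)
  then have "((\<lambda>z. A + z $ 2) has_derivative (\<lambda>h. h $ 2)) (at p)"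
    using has_derivative_add[OF has_derivative_const[of A]] by simp
  from has_derivative_divide'[OF has_derivative_const this assms, of \<alpha>]
  have 1: "((\<lambda>z. \<alpha> / (A + z $ 2)) has_derivative (\<lambda>h. - \<alpha> / (A + p $ 2)\<^sup>2 * h $ 2)) (at p)"
    by (simp add: power2_eq_square)
  have 2: "((\<lambda>z. \<gamma> * z $ 2) has_derivative (\<lambda>h. \<gamma> * h $ 2)) (at p)"
    by (intro bounded_linear_imp_has_derivative bounded_linear_const_mult bounded_linear_vec_nth)
  show ?thesis
    using 1 2
    \<comment> \<open>The basis vectors are the two axes, and the inner product with an axis picks
      out a coordinate; so facts 1 and 2 are the two components.\<close>
    by (subst has_derivative_componentwise_within)
       (auto simp: Basis_vec_def inner_axis forall_2)
qed

text \<open>The map ignores the first coordinate, whence the zero first column. Uniqueness of the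
  derivative identifies \<open>frechet_derivative\<close> with the explicit linear map.\<close>

lemma jacobian_system_map:
  assumes "A + p $ 2 \<noteq> 0"
  shows "jacobian (system_map \<alpha> A \<gamma>) p =
    vector [vector [0, - \<alpha> / (A + p $ 2)\<^sup>2], vector [0, \<gamma>]]"
  unfolding jacobian_def frechet_derivative_at[OF system_map_has_derivative[OF assms], symmetric]
  by (simp add: vec_eq_iff forall_2 matrix_def axis_def)

text \<open>The zero first column puts the first basis vector in the kernel.\<close>

lemma complex_eigenvalue_0:
  "complex_eigenvalue (vector [vector [0, c], vector [0, d]] :: real ^ 2 ^ 2) 0"
  unfolding complex_eigenvalue_def
  by (rule exI[of _ "vector [1, 0]"])
     (simp add: vec_eq_iff forall_2 matrix_vector_mult_def sum_2)

lemma complex_eigenvalue_diag: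
  assumes "d \<noteq> 0"
  shows "complex_eigenvalue (vector [vector [0, c], vector [0, d]] :: real ^ 2 ^ 2) (of_real d)"
  unfolding complex_eigenvalue_def
  \<comment> \<open>The matrix sends any vector to its second coordinate times (c, d), so (c, d)
    itself is scaled by d; it is nonzero because d is.\<close>
  by (rule exI[of _ "vector [of_real c, of_real d]"])
     (use assms in \<open>simp add: vec_eq_iff forall_2 matrix_vector_mult_def sum_2\<close>)

lemma system_map_differentiable:
  "A + p $ 2 \<noteq> 0 \<Longrightarrow> system_map \<alpha> A \<gamma> differentiable (at p)"
  using system_map_has_derivative differentiable_def by blast

section \<open>Horizontal rays and geometric growth\<close>

lemma horizontal_ray:
  assumes "v \<ge> 0"
  shows "{p \<in> state_space. p $ 2 = v} = {vector [x, v] | x. x \<ge> 0}"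
proof -
  have "p \<in> state_space \<and> p $ 2 = v \<longleftrightarrow> (\<exists>x. p = vector [x, v] \<and> x \<ge> 0)" for p
    using assms by (auto simp: state_space_def vector_2_eq_iff)
  then show ?thesis by blast
qed

text \<open>Since \<open>g ^ n \<ge> 1\<close>, the terms never drop below
  \<open>\<bar>y\<bar>\<close> in absolute value, and this bound passes to the limit. It excludes
  points off the horizontal axis from the stable manifold.\<close>

lemma geometric_tendsto_0_iff:
  fixes g y :: real
  assumes "g > 1"
  shows "(\<lambda>n. g ^ n * y) \<longlonglongrightarrow> 0 \<longleftrightarrow> y = 0"
proof
  assume lim: "(\<lambda>n. g ^ n * y) \<longlonglongrightarrow> 0"
  have "\<bar>y\<bar> \<le> \<bar>g ^ n * y\<bar>" for n
    using assms one_le_power[of g n] by (simp add: abs_mult mult_le_cancel_right1)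
  then have "\<bar>y\<bar> \<le> \<bar>0\<bar>"
    by (intro LIMSEQ_le_const[OF tendsto_rabs[OF lim]]) auto
  then show "y = 0" by simp
qed simp

lemma solution_unbounded:
  assumes sol: "is_solution (system_map \<alpha> A \<gamma>) z" and "\<gamma> > 1" "z 0 $ 2 \<noteq> 0"
  shows "filterlim (\<lambda>n. z n $ 2) at_top sequentially" "(\<lambda>n. z n $ 1) \<longlonglongrightarrow> 0"
proof -
  \<comment> \<open>Solutions start in the state space, so a nonzero second coordinate is positive
    and the divergence is towards plus infinity.\<close>
  have pos: "z 0 $ 2 > 0"
    using sol assms(3) by (simp add: is_solution_def state_space_def)
  have "filterlim (\<lambda>n. \<gamma> ^ n) at_top sequentially"
    using \<open>\<gamma> > 1\<close>
    by (intro filterlim_realpow_sequentially_gt1[THEN filterlim_at_infinity_imp_filterlim_at_top]) auto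
  then have "filterlim (\<lambda>n. \<gamma> ^ n * z 0 $ 2) at_top sequentially"
    by (intro filterlim_at_top_mult_tendsto_pos[OF tendsto_const pos])
  then show lim: "filterlim (\<lambda>n. z n $ 2) at_top sequentially"
    by (subst solution_2[OF sol])
  have "(\<lambda>n. \<alpha> / (A + z n $ 2)) \<longlonglongrightarrow> 0"
    by (intro tendsto_divide_0[OF tendsto_const] filterlim_at_top_imp_at_infinity
        filterlim_tendsto_add_at_top[OF tendsto_const lim])
  then have "(\<lambda>n. z (Suc n) $ 1) \<longlonglongrightarrow> 0"
    by (simp add: solution_1_Suc[OF sol])
  then show "(\<lambda>n. z n $ 1) \<longlonglongrightarrow> 0" by (rule LIMSEQ_imp_Suc)
qed

section \<open>Lyapunov stability by an explicit \<delta>\<close>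

lemma lyapunov_stable_system_map:
  assumes "\<alpha> \<ge> 0" "A > 0" "0 \<le> \<gamma>" "\<gamma> \<le> 1"
  shows "lyapunov_stable (system_map \<alpha> A \<gamma>) (vector [\<alpha> / A, 0])"
  unfolding lyapunov_stable_def
proof (intro allI impI)
  fix e :: real
  assume "e > 0"
  \<comment> \<open>The summand \<open>\<alpha> / A\<^sup>2\<close> bounds the error in the first
    coordinate and 1 that in the second, both relative to \<open>z 0 $ 2\<close>. The choice is
    \<delta> = e / K.\<close>
  define K where "K = \<alpha> / A\<^sup>2 + 1"
  have K: "K \<ge> 1" using assms by (simp add: K_def)
  let ?p = "vector [\<alpha> / A, 0] :: real ^ 2"
  have "dist (z n) ?p < e"
    if sol: "is_solution (system_map \<alpha> A \<gamma>) z" and d: "dist (z 0) ?p < e / K" for z n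
  proof -
    have y0: "0 \<le> z 0 $ 2" using solution_nonneg[OF sol \<open>0 \<le> \<gamma>\<close>] .
    have y0_less: "z 0 $ 2 < e / K"
      using component_le_norm_cart[of "z 0 - ?p" 2] d by (simp add: dist_norm)
    have le: "z n $ 2 \<le> z 0 $ 2" for n
      using assms y0 by (simp add: solution_2[OF sol, of n] mult_left_le_one_le power_le_one)
    show ?thesis
    proof (cases n)
      \<comment> \<open>The initial first coordinate is arbitrary, so closeness at time 0 comes from
        \<delta> itself; K \<ge> 1 gives \<delta> \<le> e.\<close>
      case 0
      have "e / K \<le> e" using K \<open>e > 0\<close> by (simp add: divide_le_eq)
      then show ?thesis using d 0 by simp
    next
      case (Suc m)
      \<comment> \<open>The first coordinate at time n depends on the second at time n - 1, that is,
        at time m.\<close>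
      define y where "y = z m $ 2"
      have y: "0 \<le> y" "y \<le> z 0 $ 2"
        using solution_nonneg[OF sol \<open>0 \<le> \<gamma>\<close>] le by (simp_all add: y_def)
      have "\<alpha> / A - \<alpha> / (A + y) = \<alpha> * y / (A * (A + y))"
        using assms y by (simp add: field_simps)
      also have "\<dots> \<le> \<alpha> * y / A\<^sup>2"
        using assms y by (intro divide_left_mono) (auto simp: power2_eq_square)
      also have "\<dots> \<le> \<alpha> / A\<^sup>2 * z 0 $ 2"
        using assms y mult_left_mono[of y "z 0 $ 2" "\<alpha> / A\<^sup>2"] by simp
      finally have "\<alpha> / A - \<alpha> / (A + y) \<le> \<alpha> / A\<^sup>2 * z 0 $ 2" .
      \<comment> \<open>The first coordinate stays below its limit value, so the one-sided estimate
        already bounds the absolute value.\<close>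
      moreover have "\<alpha> / (A + y) \<le> \<alpha> / A"
        using assms y by (intro divide_left_mono) auto
      ultimately have "\<bar>z n $ 1 - ?p $ 1\<bar> \<le> \<alpha> / A\<^sup>2 * z 0 $ 2"
        by (simp add: Suc solution_1_Suc[OF sol] flip: y_def)
      moreover have "\<bar>z n $ 2 - ?p $ 2\<bar> \<le> z 0 $ 2"
        using le[of n] solution_nonneg[OF sol \<open>0 \<le> \<gamma>\<close>, of n] by simp
      ultimately have "dist (z n) ?p \<le> K * z 0 $ 2"
        using dist_vec_2_le[of "z n" ?p] by (simp add: K_def distrib_right)
      also have "\<dots> < e"
        using y0_less K by (simp add: less_divide_eq mult.commute)
      finally show ?thesis .
    qed
  qed
  moreover have "e / K > 0" using K \<open>e > 0\<close> by simp
  ultimately show "\<exists>\<delta>>0. \<forall>z. is_solution (system_map \<alpha> A \<gamma>) z \<and> dist (z 0) ?p < \<delta> \<longrightarrow>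
      (\<forall>n. dist (z n) ?p < e)"
    by blast
qed

section \<open>The three regimes of \<open>\<gamma>\<^sub>2\<close>\<close>

theorem theorem4:
  fixes \<alpha>\<^sub>1 A\<^sub>1 \<gamma>\<^sub>2 :: real
  assumes "\<alpha>\<^sub>1 > 0" and "A\<^sub>1 > 0" and "\<gamma>\<^sub>2 > 0"
  shows
    "(\<gamma>\<^sub>2 > 1 \<longrightarrow>
        (\<forall>z. is_solution (system_map \<alpha>\<^sub>1 A\<^sub>1 \<gamma>\<^sub>2) z \<and> z 0 $ 2 \<noteq> 0 \<longrightarrow>
           ((\<lambda>n. z n $ 1) \<longlonglongrightarrow> 0) \<and> filterlim (\<lambda>n. z n $ 2) at_top sequentially) \<and>
        saddle_equilibrium (system_map \<alpha>\<^sub>1 A\<^sub>1 \<gamma>\<^sub>2) (vector [\<alpha>\<^sub>1 / A\<^sub>1, 0]) \<and>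
        stable_manifold (system_map \<alpha>\<^sub>1 A\<^sub>1 \<gamma>\<^sub>2) (vector [\<alpha>\<^sub>1 / A\<^sub>1, 0]) = {vector [x, 0] | x. x \<ge> 0}) \<and>
     (\<gamma>\<^sub>2 = 1 \<longrightarrow>
        (\<forall>p \<in> {vector [\<alpha>\<^sub>1 / (A\<^sub>1 + v), v] | v. v \<ge> 0}.
           nonhyperbolic_equilibrium (system_map \<alpha>\<^sub>1 A\<^sub>1 \<gamma>\<^sub>2) p) \<and>
        (\<forall>v\<ge>0. stable_manifold (system_map \<alpha>\<^sub>1 A\<^sub>1 \<gamma>\<^sub>2) (vector [\<alpha>\<^sub>1 / (A\<^sub>1 + v), v])
                 = {vector [x, v] | x. x \<ge> 0})) \<and>
     (\<gamma>\<^sub>2 < 1 \<longrightarrow>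
        (\<forall>p. equilibrium (system_map \<alpha>\<^sub>1 A\<^sub>1 \<gamma>\<^sub>2) p \<longleftrightarrow> p = vector [\<alpha>\<^sub>1 / A\<^sub>1, 0]) \<and>
        globally_asymptotically_stable (system_map \<alpha>\<^sub>1 A\<^sub>1 \<gamma>\<^sub>2) (vector [\<alpha>\<^sub>1 / A\<^sub>1, 0]))"
proof (intro conjI impI)
  let ?F = "system_map \<alpha>\<^sub>1 A\<^sub>1 \<gamma>\<^sub>2"
  let ?p = "vector [\<alpha>\<^sub>1 / A\<^sub>1, 0] :: real ^ 2"
  note manifold = stable_manifold_system_map[OF \<open>A\<^sub>1 > 0\<close>, of _ \<alpha>\<^sub>1 \<gamma>\<^sub>2]
  {
    assume "\<gamma>\<^sub>2 > 1"
    then show "\<forall>z. is_solution ?F z \<and> z 0 $ 2 \<noteq> 0 \<longrightarrow>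
        ((\<lambda>n. z n $ 1) \<longlonglongrightarrow> 0) \<and> filterlim (\<lambda>n. z n $ 2) at_top sequentially"
      using solution_unbounded by blast
    have nz: "A\<^sub>1 + ?p $ 2 \<noteq> 0" using assms by simp
    have "equilibrium ?F ?p"
      using assms by (simp add: equilibrium_system_map_iff state_space_def)
    moreover have "norm (0 :: complex) < 1" "norm (complex_of_real \<gamma>\<^sub>2) > 1"
      using \<open>\<gamma>\<^sub>2 > 1\<close> by simp_all
    ultimately show "saddle_equilibrium ?F ?p"
      unfolding saddle_equilibrium_def jacobian_system_map[OF nz]
      using system_map_differentiable[OF nz] complex_eigenvalue_0
        complex_eigenvalue_diag[of \<gamma>\<^sub>2] \<open>\<gamma>\<^sub>2 > 0\<close>
      by blast
    \<comment> \<open>In the instance \<open>v = 0\<close> convergence to the equilibrium means that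
      the second coordinate vanishes initially.\<close>
    show "stable_manifold ?F ?p = {vector [x, 0] | x. x \<ge> 0}"
      using manifold[of 0] horizontal_ray[of 0] by (simp add: geometric_tendsto_0_iff[OF \<open>\<gamma>\<^sub>2 > 1\<close>])
  next
    assume [simp]: "\<gamma>\<^sub>2 = 1"
    show "\<forall>p \<in> {vector [\<alpha>\<^sub>1 / (A\<^sub>1 + v), v] | v. v \<ge> 0}. nonhyperbolic_equilibrium ?F p"
    proof
      fix p :: "real ^ 2"
      assume "p \<in> {vector [\<alpha>\<^sub>1 / (A\<^sub>1 + v), v] | v. v \<ge> 0}"
      then obtain v where v: "v \<ge> 0" and p: "p = vector [\<alpha>\<^sub>1 / (A\<^sub>1 + v), v]" by blast
      have nz: "A\<^sub>1 + p $ 2 \<noteq> 0" using assms v p by simp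
      have "equilibrium ?F p"
        using assms v by (simp add: equilibrium_system_map_iff state_space_def p)
      moreover have "norm (complex_of_real \<gamma>\<^sub>2) = 1" by simp
      ultimately show "nonhyperbolic_equilibrium ?F p"
        unfolding nonhyperbolic_equilibrium_def jacobian_system_map[OF nz]
        using system_map_differentiable[OF nz] complex_eigenvalue_diag[of \<gamma>\<^sub>2] \<open>\<gamma>\<^sub>2 > 0\<close>
        by blast
    qed
    \<comment> \<open>For ratio 1 the geometric sequence is constant, so it tends to v exactly when
      it starts at v.\<close>
    show "\<forall>v\<ge>0. stable_manifold ?F (vector [\<alpha>\<^sub>1 / (A\<^sub>1 + v), v]) = {vector [x, v] | x. x \<ge> 0}"
      using manifold horizontal_ray by (simp add: LIMSEQ_const_iff)
  next
    assume "\<gamma>\<^sub>2 < 1"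
    \<comment> \<open>A ratio different from 1 leaves 0 as the only fixed second coordinate, and
      this determines the first.\<close>
    then show eq: "\<forall>p. equilibrium ?F p \<longleftrightarrow> p = ?p"
      using assms by (auto simp: equilibrium_system_map_iff state_space_def vector_2_eq_iff)
    have "(\<lambda>n. \<gamma>\<^sub>2 ^ n * y) \<longlonglongrightarrow> 0" for y
      using \<open>\<gamma>\<^sub>2 < 1\<close> \<open>\<gamma>\<^sub>2 > 0\<close> by (intro tendsto_mult_left_zero LIMSEQ_realpow_zero) auto
    then have "z \<longlonglongrightarrow> ?p" if "is_solution ?F z" for z
      using solution_tendsto_iff[OF that \<open>A\<^sub>1 > 0\<close>, of 0] by simp
    then show "globally_asymptotically_stable ?F ?p"
      using eq lyapunov_stable_system_map[of \<alpha>\<^sub>1 A\<^sub>1 \<gamma>\<^sub>2] assms \<open>\<gamma>\<^sub>2 < 1\<close>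
      by (simp add: globally_asymptotically_stable_def)
  }
qed

end
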